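(* Let $G$ be a countable group. The following are equivalent: (1) the space of ends $\mathcal{E}^\star(G)$ of $G$ is metrizable; (2) there is no continuous surjective map from the space of ends of $G$ onto the Stone-Čech compactification of $\mathbf{N}$; (3) $G$ is tamely-ended.
   Context: A subset $A$ of a group $G$ is left $G$-commensurated if $gA\bigtriangleup A$ is finite for every $g\in G$. These subsets form a Boolean subalgebra $\mathcal{P}_{(G)}(G)$ of the power set of $G$; $\mathcal{P}^\star_G(G)$ denotes its quotient by the ideal of finite subsets of $G$. The space of ends $\mathcal{E}^\star(G)$ is the Stone dual of $\mathcal{P}^\star_G(G)$, i.e. the compact Hausdorff totally disconnected space whose Boolean algebra of clopen subsets is $\mathcal{P}^\star_G(G)$ (empty if $G$ is finite). For a set $I$, a function $f:G\to I$ is left $G$-almost invariant if for every $g\in G$ the set of $h\in G$ with $f(gh)\neq f(h)$ is finite. $G$ is tamely-ended if every left $G$-almost invariant function on $G$ (to any set) has finite image, and untamely-ended otherwise. *)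

theory Defs
  imports "HOL-Analysis.Analysis" "HOL-Algebra.Coset"
begin

section \<open>The Stone dual of a Boolean algebra\<close>

text \<open>A Boolean algebra is given through its order, as an ordered structure with a carrier.
  Its ultrafilters are its maximal proper filters. The one-element algebra has only the improper
  filter, so its Stone dual is empty.\<close>

definition order_filter :: "('b, 'c) gorder_scheme \<Rightarrow> 'b set \<Rightarrow> bool" where
  "order_filter L F \<longleftrightarrow>
     F \<subseteq> carrier L \<and> F \<noteq> {} \<and>
     (\<forall>x\<in>F. \<forall>y\<in>carrier L. x \<sqsubseteq>\<^bsub>L\<^esub> y \<longrightarrow> y \<in> F) \<and>
     (\<forall>x\<in>F. \<forall>y\<in>F. \<exists>z\<in>F. z \<sqsubseteq>\<^bsub>L\<^esub> x \<and> z \<sqsubseteq>\<^bsub>L\<^esub> y)"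

definition proper_filter :: "('b, 'c) gorder_scheme \<Rightarrow> 'b set \<Rightarrow> bool" where
  "proper_filter L F \<longleftrightarrow> order_filter L F \<and> F \<noteq> carrier L"

definition ultrafilters :: "('b, 'c) gorder_scheme \<Rightarrow> 'b set set" where
  "ultrafilters L = {U. proper_filter L U \<and> (\<forall>F. proper_filter L F \<and> U \<subseteq> F \<longrightarrow> F = U)}"

definition stone_dual :: "('b, 'c) gorder_scheme \<Rightarrow> 'b set topology" where
  "stone_dual L = topology_generated_by ((\<lambda>a. {U \<in> ultrafilters L. a \<in> U}) ` carrier L)"

lemma topspace_stone_dual: "topspace (stone_dual L) = ultrafilters L"
proof -
  have "U \<in> \<Union> ((\<lambda>a. {U \<in> ultrafilters L. a \<in> U}) ` carrier L)" if "U \<in> ultrafilters L" for U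
  proof -
    have "U \<noteq> {}" "U \<subseteq> carrier L"
      using that unfolding ultrafilters_def proper_filter_def order_filter_def by simp_all
    then show ?thesis
      using that by blast
  qed
  then show ?thesis
    unfolding stone_dual_def topology_generated_by_topspace by blast
qed

section \<open>Commensurated subsets and the space of ends\<close>

definition left_commensurated :: "('a, 'b) monoid_scheme \<Rightarrow> 'a set set" where
  "left_commensurated G =
     {A. A \<subseteq> carrier G \<and> (\<forall>g\<in>carrier G. finite (sym_diff (g <#\<^bsub>G\<^esub> A) A))}"

definition near_equal :: "('a, 'b) monoid_scheme \<Rightarrow> ('a set \<times> 'a set) set" where
  "near_equal G =
     {(A, B). A \<in> left_commensurated G \<and> B \<in> left_commensurated G \<and> finite (sym_diff A B)}"

text \<open>In the quotient by the ideal of finite subsets, the class of \<open>A\<close> is below the class of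
  \<open>B\<close> iff \<open>A - B\<close> lies in the ideal (see \<open>le_ends_algebra_iff\<close> below).\<close>

definition ends_algebra :: "('a, 'b) monoid_scheme \<Rightarrow> 'a set set gorder" where
  "ends_algebra G =
     \<lparr>carrier = left_commensurated G // near_equal G, eq = (=),
      le = (\<lambda>X Y. \<exists>A\<in>X. \<exists>B\<in>Y. finite (A - B))\<rparr>"

definition space_of_ends :: "('a, 'b) monoid_scheme \<Rightarrow> 'a set set set topology" where
  "space_of_ends G = stone_dual (ends_algebra G)"

lemma equiv_near_equal: "equiv (left_commensurated G) (near_equal G)"
proof (rule equivI)
  show "near_equal G \<subseteq> left_commensurated G \<times> left_commensurated G"
    by (auto simp: near_equal_def)
  show "refl_on (left_commensurated G) (near_equal G)"
    by (auto simp: refl_on_def near_equal_def)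
  show "sym (near_equal G)"
    by (auto simp: sym_def near_equal_def)
  show "trans (near_equal G)"
  proof (rule transI)
    fix A B C assume AB: "(A, B) \<in> near_equal G" and BC: "(B, C) \<in> near_equal G"
    have "sym_diff A C \<subseteq> sym_diff A B \<union> sym_diff B C"
      by auto
    moreover have "finite (sym_diff A B \<union> sym_diff B C)"
      using AB BC by (simp add: near_equal_def)
    ultimately have "finite (sym_diff A C)"
      by (rule finite_subset)
    then show "(A, C) \<in> near_equal G"
      using AB BC by (auto simp: near_equal_def)
  qed
qed

lemma le_ends_algebra_iff:
  assumes "A \<in> left_commensurated G" "B \<in> left_commensurated G"
  shows "near_equal G `` {A} \<sqsubseteq>\<^bsub>ends_algebra G\<^esub> near_equal G `` {B} \<longleftrightarrow> finite (A - B)"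
proof
  assume "near_equal G `` {A} \<sqsubseteq>\<^bsub>ends_algebra G\<^esub> near_equal G `` {B}"
  then obtain A' B' where "(A, A') \<in> near_equal G" "(B, B') \<in> near_equal G" "finite (A' - B')"
    by (auto simp: ends_algebra_def)
  then have "finite ((A - A') \<union> (A' - B') \<union> (B' - B))"
    by (simp add: near_equal_def)
  moreover have "A - B \<subseteq> (A - A') \<union> (A' - B') \<union> (B' - B)"
    by auto
  ultimately show "finite (A - B)"
    by (rule finite_subset[rotated])
next
  assume "finite (A - B)"
  moreover have "A \<in> near_equal G `` {A}" "B \<in> near_equal G `` {B}"
    using assms by (auto simp: near_equal_def)
  ultimately show "near_equal G `` {A} \<sqsubseteq>\<^bsub>ends_algebra G\<^esub> near_equal G `` {B}"
    by (auto simp: ends_algebra_def)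
qed

section \<open>Tamely-ended groups\<close>

definition left_almost_invariant :: "('a, 'b) monoid_scheme \<Rightarrow> ('a \<Rightarrow> 'i) \<Rightarrow> bool" where
  "left_almost_invariant G f \<longleftrightarrow>
     (\<forall>g\<in>carrier G. finite {h \<in> carrier G. f (g \<otimes>\<^bsub>G\<^esub> h) \<noteq> f h})"

text \<open>A definition cannot quantify over all codomains. Functions with values in the type of the
  group elements suffice, because a function on \<open>G\<close> takes at most as many values as \<open>G\<close> has
  elements; the lemma \<open>tamely_ended_any_codomain\<close> recovers arbitrary codomains.\<close>

definition tamely_ended :: "('a, 'b) monoid_scheme \<Rightarrow> bool" where
  "tamely_ended G \<longleftrightarrow>
     (\<forall>f :: 'a \<Rightarrow> 'a. left_almost_invariant G f \<longrightarrow> finite (f ` carrier G))"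

lemma tamely_ended_any_codomain:
  fixes f :: "'a \<Rightarrow> 'i"
  assumes G: "group G" and tame: "tamely_ended G" and f: "left_almost_invariant G f"
  shows "finite (f ` carrier G)"
proof -
  interpret group G by (rule G)
  define r where "r = inv_into (carrier G) f"
  have inj: "inj_on r (f ` carrier G)"
    unfolding r_def by (rule inj_on_inv_into) simp
  have "{h \<in> carrier G. (r \<circ> f) (g \<otimes>\<^bsub>G\<^esub> h) \<noteq> (r \<circ> f) h} \<subseteq> {h \<in> carrier G. f (g \<otimes>\<^bsub>G\<^esub> h) \<noteq> f h}"
    for g
    by auto
  then have "left_almost_invariant G (r \<circ> f)"
    using f unfolding left_almost_invariant_def by (blast intro: finite_subset)
  then have "finite ((r \<circ> f) ` carrier G)"
    using tame unfolding tamely_ended_def by blast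
  then have "finite (r ` f ` carrier G)"
    by (simp only: image_comp)
  then show ?thesis
    using inj by (rule finite_imageD)
qed

section \<open>The Stone-Cech compactification\<close>

text \<open>The closure of the image of \<open>X\<close> under evaluation in the cube indexed by all continuous
  functions from \<open>X\<close> to the unit interval.\<close>

definition unit_functions :: "'a topology \<Rightarrow> ('a \<Rightarrow> real) set" where
  "unit_functions X = {\<phi>. continuous_map X (top_of_set {0..1}) \<phi>}"

definition stone_cech :: "'a topology \<Rightarrow> (('a \<Rightarrow> real) \<Rightarrow> real) topology" where
  "stone_cech X =
     (let Q = product_topology (\<lambda>\<phi>. top_of_set {0..1}) (unit_functions X)
      in subtopology Q
           (Q closure_of ((\<lambda>x. \<lambda>\<phi>\<in>unit_functions X. \<phi> x) ` topspace X)))"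

end

theory Submission
  imports Defs
begin

text \<open>
  The link between almost invariant functions and ends is that a function \<open>f\<close> on \<open>G\<close> is left almost
  invariant only if every preimage under \<open>f\<close> is commensurated. So \<open>f\<close> converts subsets of its
  codomain into elements of the algebra of ends.

  If \<open>G\<close> is tamely-ended, it has only countably many commensurated subsets
  (\<open>tamely_ended_imp_countable_left_commensurated\<close>). Enumerate \<open>G\<close> as \<open>e 0, e 1, \<dots>\<close>. Were there
  uncountably many, then for each \<open>n\<close> two of them would have the same boundary with respect to
  \<open>e 0, \<dots>, e (n - 1)\<close>, these boundaries being finite subsets of a countable set, and the same trace on
  \<open>{e 0, \<dots>, e (n - 1)}\<close>. Their symmetric difference \<open>C n\<close> is nonempty, commensurated, exactly
  invariant under \<open>e 0, \<dots>, e (n - 1)\<close>, and it avoids these elements. Each \<open>h\<close> then lies in finitely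
  many \<open>C n\<close> only, and \<open>h \<mapsto> {n. h \<in> C n}\<close> is almost invariant with infinite image. Now the space of
  ends is the Stone dual of a countable algebra. Being compact (\<open>compact_space_of_ends\<close>), it embeds
  into a countable power of the two-point space, so it is metrizable.

  A compact metrizable space has no continuous map onto the Stone-Cech compactification of the
  naturals. It is sequentially compact, so some subsequence of the naturals would converge in the
  compactification; but there is a function with values 0 and 1 that alternates along this
  subsequence (\<open>compact_metrizable_no_map_onto_stone_cech_nat\<close>).

  If \<open>G\<close> is untamely-ended, there is an almost invariant \<open>f\<close> from \<open>G\<close> to the naturals all of whose
  fibres are infinite. Every bounded function \<open>\<phi> \<circ> f\<close> has a limit along each end \<open>U\<close>. The map that
  sends \<open>U\<close> to the family of these limits is continuous, with values in the Stone-Cech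
  compactification. As each fibre is infinite, it belongs to some end, so that the image contains
  the naturals; by compactness it is everything (\<open>untamely_ended_map_onto_stone_cech_nat\<close>).
\<close>

section \<open>Almost invariant functions and commensurated subsets\<close>

lemma left_almost_invariant_combine:
  assumes "left_almost_invariant G f" "left_almost_invariant G k"
  shows "left_almost_invariant G (\<lambda>h. F (f h) (k h))"
  unfolding left_almost_invariant_def
proof
  fix g assume "g \<in> carrier G"
  then have "finite ({h \<in> carrier G. f (g \<otimes>\<^bsub>G\<^esub> h) \<noteq> f h} \<union> {h \<in> carrier G. k (g \<otimes>\<^bsub>G\<^esub> h) \<noteq> k h})"
    using assms by (simp add: left_almost_invariant_def)
  then show "finite {h \<in> carrier G. F (f (g \<otimes>\<^bsub>G\<^esub> h)) (k (g \<otimes>\<^bsub>G\<^esub> h)) \<noteq> F (f h) (k h)}"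
    by (rule finite_subset[rotated]) auto
qed

lemma left_almost_invariant_compose:
  "left_almost_invariant G f \<Longrightarrow> left_almost_invariant G (\<lambda>h. F (f h))"
  using left_almost_invariant_combine[of G f f "\<lambda>x y. F x"] by simp

text \<open>Translating \<open>A\<close> by \<open>g\<close> amounts to composing its membership predicate with the translation by
  the inverse of \<open>g\<close>. Thus the Boolean operations and preimages below are all instances of
  composing almost invariant functions.\<close>

lemma (in group) left_commensurated_iff:
  "A \<in> left_commensurated G \<longleftrightarrow> A \<subseteq> carrier G \<and> left_almost_invariant G (\<lambda>h. h \<in> A)"
proof (cases "A \<subseteq> carrier G")
  case True
  have eq: "sym_diff (g <#\<^bsub>G\<^esub> A) A = {h \<in> carrier G. (inv g \<otimes> h \<in> A) \<noteq> (h \<in> A)}"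
    if g: "g \<in> carrier G" for g
  proof -
    have "h \<in> g <#\<^bsub>G\<^esub> A \<longleftrightarrow> inv g \<otimes> h \<in> A" if h: "h \<in> carrier G" for h
    proof
      assume "h \<in> g <#\<^bsub>G\<^esub> A"
      then obtain a where "a \<in> A" "h = g \<otimes> a"
        by (auto simp: l_coset_def)
      moreover have "inv g \<otimes> (g \<otimes> a) = a"
        using True g \<open>a \<in> A\<close> by (simp add: inv_solve_left' subset_iff)
      ultimately show "inv g \<otimes> h \<in> A"
        by simp
    next
      assume "inv g \<otimes> h \<in> A"
      moreover have "h = g \<otimes> (inv g \<otimes> h)"
        using g h by (metis inv_closed inv_solve_left m_closed)
      ultimately show "h \<in> g <#\<^bsub>G\<^esub> A"
        by (auto simp: l_coset_def)
    qed
    moreover have "g <#\<^bsub>G\<^esub> A \<subseteq> carrier G"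
      using True g by (auto simp: l_coset_def)
    ultimately show ?thesis
      using True by auto
  qed
  have "(\<forall>g\<in>carrier G. finite (sym_diff (g <#\<^bsub>G\<^esub> A) A)) \<longleftrightarrow>
        (\<forall>g\<in>carrier G. finite {h \<in> carrier G. (inv g \<otimes> h \<in> A) \<noteq> (h \<in> A)})"
    by (simp add: eq)
  also have "\<dots> \<longleftrightarrow> (\<forall>g\<in>carrier G. finite {h \<in> carrier G. (g \<otimes> h \<in> A) \<noteq> (h \<in> A)})"
  proof (intro iffI ballI)
    fix g assume "g \<in> carrier G"
      and "\<forall>g\<in>carrier G. finite {h \<in> carrier G. (inv g \<otimes> h \<in> A) \<noteq> (h \<in> A)}"
    from this(2)[rule_format, of "inv g"] this(1)
    show "finite {h \<in> carrier G. (g \<otimes> h \<in> A) \<noteq> (h \<in> A)}"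
      by simp
  qed simp
  finally show ?thesis
    using True by (simp add: left_commensurated_def left_almost_invariant_def)
qed (simp add: left_commensurated_def)

lemma (in group) left_commensurated_Collect:
  assumes "left_almost_invariant G P"
  shows "{h \<in> carrier G. P h} \<in> left_commensurated G"
  unfolding left_commensurated_iff left_almost_invariant_def
proof (intro conjI ballI)
  fix g assume g: "g \<in> carrier G"
  with assms have fin: "finite {h \<in> carrier G. P (g \<otimes> h) \<noteq> P h}"
    unfolding left_almost_invariant_def by (rule bspec)
  show "finite {h \<in> carrier G. (g \<otimes> h \<in> {h \<in> carrier G. P h}) \<noteq> (h \<in> {h \<in> carrier G. P h})}"
    by (rule finite_subset[OF _ fin]) (use g in auto)
qed blast

lemma (in group) left_commensurated_combine:
  assumes "A \<in> left_commensurated G" "B \<in> left_commensurated G"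
  shows "{h \<in> carrier G. F (h \<in> A) (h \<in> B)} \<in> left_commensurated G"
  using assms
  by (simp add: left_commensurated_Collect left_almost_invariant_combine[of G "\<lambda>h. h \<in> A" "\<lambda>h. h \<in> B" F]
      left_commensurated_iff[of A] left_commensurated_iff[of B])

lemma (in group) left_commensurated_empty: "{} \<in> left_commensurated G"
  and left_commensurated_carrier: "carrier G \<in> left_commensurated G"
  using left_commensurated_Collect[of "\<lambda>_. False"] left_commensurated_Collect[of "\<lambda>_. True"]
  by (simp_all add: left_almost_invariant_def)

lemma (in group) left_commensurated_Compl:
  assumes "A \<in> left_commensurated G" shows "carrier G - A \<in> left_commensurated G"
  using left_commensurated_combine[OF assms assms, of "\<lambda>x y. \<not> x"] by (simp add: set_diff_eq)

lemma (in group) left_commensurated_Int: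
  assumes "A \<in> left_commensurated G" "B \<in> left_commensurated G"
  shows "A \<inter> B \<in> left_commensurated G"
proof -
  have "{h \<in> carrier G. h \<in> A \<and> h \<in> B} = A \<inter> B"
    using assms by (auto simp: left_commensurated_iff)
  then show ?thesis
    using left_commensurated_combine[OF assms, of "(\<and>)"] by simp
qed

lemma (in group) left_commensurated_sym_diff:
  assumes "A \<in> left_commensurated G" "B \<in> left_commensurated G"
  shows "sym_diff A B \<in> left_commensurated G"
proof -
  have "{h \<in> carrier G. (h \<in> A) \<noteq> (h \<in> B)} = sym_diff A B"
    using assms by (auto simp: left_commensurated_iff)
  then show ?thesis
    using left_commensurated_combine[OF assms, of "(\<noteq>)"] by simp
qed

section \<open>Tamely-ended countable groups have countably many commensurated subsets\<close>

text \<open>A pigeonhole argument: the boundaries with respect to the finitely many elements of \<open>S\<close> and the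
  trace on \<open>F\<close> take countably many values, so two distinct commensurated sets share them. Equal
  boundaries cancel in the symmetric difference, which is thereby invariant under \<open>S\<close>.\<close>

lemma (in group) uncountable_imp_invariant_left_commensurated:
  assumes unc: "uncountable (left_commensurated G)" and G: "countable (carrier G)"
    and S: "finite S" "S \<subseteq> carrier G" and F: "finite F"
  obtains C where "C \<in> left_commensurated G" "C \<noteq> {}" "C \<inter> F = {}"
    "\<And>g h. g \<in> S \<Longrightarrow> h \<in> carrier G \<Longrightarrow> g \<otimes> h \<in> C \<longleftrightarrow> h \<in> C"
proof -
  obtain gs where gs: "set gs = S"
    using S finite_list by blast
  define boundary where "boundary A g = {h \<in> carrier G. (g \<otimes> h \<in> A) \<noteq> (h \<in> A)}" for A g
  define data where "data A = (map (boundary A) gs, A \<inter> F)" for A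
  define D where "D = {X. finite X \<and> X \<subseteq> carrier G}"
  have "boundary A g \<in> D" if "A \<in> left_commensurated G" "g \<in> S" for A g
    using that S by (auto simp: D_def boundary_def left_commensurated_iff left_almost_invariant_def)
  then have "data ` left_commensurated G \<subseteq> lists D \<times> Pow F"
    by (auto simp: data_def gs)
  moreover have "countable (lists D \<times> Pow F)"
    using countable_Collect_finite_subset[OF G] F
    by (intro countable_SIGMA countable_lists) (auto simp: D_def countable_finite)
  ultimately have "countable (data ` left_commensurated G)"
    by (rule countable_subset)
  with unc have "\<not> inj_on data (left_commensurated G)"
    by (meson countable_image_inj_on)
  then obtain A B where AB: "A \<in> left_commensurated G" "B \<in> left_commensurated G" "A \<noteq> B"
    and eq: "data A = data B"
    by (auto simp: inj_on_def)
  show thesis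
  proof
    show "sym_diff A B \<in> left_commensurated G"
      by (rule left_commensurated_sym_diff) (use AB in auto)
    show "sym_diff A B \<noteq> {}" "sym_diff A B \<inter> F = {}"
      using AB eq by (auto simp: data_def)
    fix g h assume "g \<in> S" "h \<in> carrier G"
    moreover have "boundary A g = boundary B g"
      using eq \<open>g \<in> S\<close> by (auto simp: data_def gs)
    ultimately show "g \<otimes> h \<in> sym_diff A B \<longleftrightarrow> h \<in> sym_diff A B"
      unfolding boundary_def by blast
  qed
qed

text \<open>The invariance of \<open>C n\<close> under ever more elements lets the infinitely many sets \<open>C n\<close> be combined:
  a fixed \<open>g\<close> moves only finitely many of them, and each of those by a finite set. That \<open>C n\<close> avoids
  ever more elements makes the combined function take finite sets as values; these cover all
  indices, so there are infinitely many of them.\<close>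

lemma (in group) tamely_ended_imp_countable_left_commensurated:
  assumes G: "countable (carrier G)" and tame: "tamely_ended G"
  shows "countable (left_commensurated G)"
proof (rule ccontr)
  assume unc: "uncountable (left_commensurated G)"
  have ne: "carrier G \<noteq> {}"
    by auto
  define e where "e = from_nat_into (carrier G)"
  have e: "range e = carrier G"
    unfolding e_def by (rule range_from_nat_into[OF ne G])
  have "\<exists>C. C \<in> left_commensurated G \<and> C \<noteq> {} \<and> C \<inter> e ` {..<n} = {} \<and>
           (\<forall>g \<in> e ` {..<n}. \<forall>h \<in> carrier G. g \<otimes> h \<in> C \<longleftrightarrow> h \<in> C)" for n
    using uncountable_imp_invariant_left_commensurated[OF unc G, of "e ` {..<n}" "e ` {..<n}"] e
    by (metis finite_imageI finite_lessThan image_mono top_greatest)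
  then obtain C where C: "\<And>n. C n \<in> left_commensurated G" "\<And>n. C n \<noteq> {}"
    and avoid: "\<And>n. C n \<inter> e ` {..<n} = {}"
    and inv: "\<And>n g h. g \<in> e ` {..<n} \<Longrightarrow> h \<in> carrier G \<Longrightarrow> g \<otimes> h \<in> C n \<longleftrightarrow> h \<in> C n"
    by metis
  define f where "f h = {n. h \<in> C n}" for h
  have "left_almost_invariant G f"
    unfolding left_almost_invariant_def
  proof
    fix g assume g: "g \<in> carrier G"
    then obtain k where k: "g = e k"
      using e by auto
    have "{h \<in> carrier G. f (g \<otimes> h) \<noteq> f h} \<subseteq>
          (\<Union>n\<le>k. {h \<in> carrier G. (g \<otimes> h \<in> C n) \<noteq> (h \<in> C n)})"
    proof
      fix h assume "h \<in> {h \<in> carrier G. f (g \<otimes> h) \<noteq> f h}"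
      then obtain n where n: "h \<in> carrier G" "(g \<otimes> h \<in> C n) \<noteq> (h \<in> C n)"
        by (auto simp: f_def)
      then have "\<not> k < n"
        using inv[of g n h] k by auto
      with n show "h \<in> (\<Union>n\<le>k. {h \<in> carrier G. (g \<otimes> h \<in> C n) \<noteq> (h \<in> C n)})"
        by auto
    qed
    moreover have "finite {h \<in> carrier G. (g \<otimes> h \<in> C n) \<noteq> (h \<in> C n)}" for n
      using C(1)[of n] g by (simp add: left_commensurated_iff left_almost_invariant_def)
    ultimately show "finite {h \<in> carrier G. f (g \<otimes> h) \<noteq> f h}"
      by (meson finite_UN finite_atMost finite_subset)
  qed
  then have "finite (f ` carrier G)"
    using tamely_ended_any_codomain[OF is_group tame] by blast
  moreover have "finite (f h)" if "h \<in> carrier G" for h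
  proof -
    have "h \<in> range e"
      using e that by simp
    then obtain k where "h = e k"
      by blast
    then have "f h \<subseteq> {..k}"
      using avoid by (fastforce simp: f_def not_le)
    then show ?thesis
      by (rule finite_subset) simp
  qed
  ultimately have "finite (\<Union> (f ` carrier G))"
    by blast
  moreover have "n \<in> \<Union> (f ` carrier G)" for n
    using C[of n] by (auto simp: f_def left_commensurated_iff)
  then have "\<Union> (f ` carrier G) = UNIV"
    by blast
  ultimately show False
    by simp
qed

section \<open>Ends as ultrafilters of commensurated subsets\<close>

text \<open>Working with the commensurated sets that represent members of an end, rather than with their
  near-equality classes, turns the order of the algebra into inclusion up to a finite set.\<close>

definition end_sets :: "('a, 'b) monoid_scheme \<Rightarrow> 'a set set set \<Rightarrow> 'a set set" where
  "end_sets G U = {A \<in> left_commensurated G. near_equal G `` {A} \<in> U}"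

lemma carrier_ends_algebra: "carrier (ends_algebra G) = (\<lambda>A. near_equal G `` {A}) ` left_commensurated G"
  by (auto simp: ends_algebra_def quotient_def)

lemma end_sets_subset: "end_sets G U \<subseteq> left_commensurated G"
  by (auto simp: end_sets_def)

lemma order_filter_ends_algebra_iff:
  assumes "U \<subseteq> carrier (ends_algebra G)"
  shows "order_filter (ends_algebra G) U \<longleftrightarrow>
     end_sets G U \<noteq> {} \<and>
     (\<forall>A\<in>end_sets G U. \<forall>B\<in>left_commensurated G. finite (A - B) \<longrightarrow> B \<in> end_sets G U) \<and>
     (\<forall>A\<in>end_sets G U. \<forall>B\<in>end_sets G U. \<exists>C\<in>end_sets G U. finite (C - A) \<and> finite (C - B))"
proof -
  have U: "U = (\<lambda>A. near_equal G `` {A}) ` end_sets G U"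
    using assms by (auto simp: carrier_ends_algebra end_sets_def)
  have mem: "near_equal G `` {B} \<in> U \<longleftrightarrow> B \<in> end_sets G U" if "B \<in> left_commensurated G" for B
    using that by (simp add: end_sets_def)
  have lc: "A \<in> left_commensurated G" if "A \<in> end_sets G U" for A
    using that by (simp add: end_sets_def)
  have up: "(\<forall>x\<in>U. \<forall>y\<in>carrier (ends_algebra G). x \<sqsubseteq>\<^bsub>ends_algebra G\<^esub> y \<longrightarrow> y \<in> U) \<longleftrightarrow>
     (\<forall>A\<in>end_sets G U. \<forall>B\<in>left_commensurated G. finite (A - B) \<longrightarrow> B \<in> end_sets G U)"
    by (subst U) (simp add: carrier_ends_algebra le_ends_algebra_iff mem lc)
  have down: "(\<forall>x\<in>U. \<forall>y\<in>U. \<exists>z\<in>U. z \<sqsubseteq>\<^bsub>ends_algebra G\<^esub> x \<and> z \<sqsubseteq>\<^bsub>ends_algebra G\<^esub> y) \<longleftrightarrow>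
     (\<forall>A\<in>end_sets G U. \<forall>B\<in>end_sets G U. \<exists>C\<in>end_sets G U. finite (C - A) \<and> finite (C - B))"
    by (subst (1 2 3) U) (simp add: le_ends_algebra_iff lc)
  have "U \<noteq> {} \<longleftrightarrow> end_sets G U \<noteq> {}"
    by (subst U) simp
  with assms up down show ?thesis
    unfolding order_filter_def by simp
qed


text \<open>The class of the empty set is the bottom of the algebra, and a filter is improper exactly when
  it contains the bottom.\<close>

lemma proper_filter_ends_algebra_iff:
  assumes "order_filter (ends_algebra G) U" and ne: "{} \<in> left_commensurated G"
  shows "U \<noteq> carrier (ends_algebra G) \<longleftrightarrow> {} \<notin> end_sets G U"
proof -
  have sub: "U \<subseteq> carrier (ends_algebra G)"
    using assms by (simp add: order_filter_def)
  have "end_sets G U = left_commensurated G" if "{} \<in> end_sets G U"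
    using that order_filter_ends_algebra_iff[OF sub] assms(1) by (auto simp: end_sets_def)
  moreover have "U = carrier (ends_algebra G) \<longleftrightarrow> end_sets G U = left_commensurated G"
    using sub by (auto simp: carrier_ends_algebra end_sets_def)
  ultimately show ?thesis
    using ne by blast
qed

context group
begin

text \<open>Both constructions of filters below, by adjoining one set and by generating from a family, pass
  through this criterion for a family of commensurated sets to come from a proper filter.\<close>

lemma filter_of_left_commensurated:
  assumes T: "T \<subseteq> left_commensurated G" "carrier G \<in> T" "{} \<notin> T"
    and up: "\<And>A B. A \<in> T \<Longrightarrow> B \<in> left_commensurated G \<Longrightarrow> finite (A - B) \<Longrightarrow> B \<in> T"
    and Int: "\<And>A B. A \<in> T \<Longrightarrow> B \<in> T \<Longrightarrow> A \<inter> B \<in> T"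
  shows end_sets_filter_of_left_commensurated: "end_sets G ((\<lambda>A. near_equal G `` {A}) ` T) = T"
    and proper_filter_of_left_commensurated:
      "proper_filter (ends_algebra G) ((\<lambda>A. near_equal G `` {A}) ` T)"
proof -
  let ?F = "(\<lambda>A. near_equal G `` {A}) ` T"
  have F: "?F \<subseteq> carrier (ends_algebra G)"
    using T(1) by (auto simp: carrier_ends_algebra)
  show es: "end_sets G ?F = T"
  proof
    show "T \<subseteq> end_sets G ?F"
      using T(1) by (auto simp: end_sets_def)
    show "end_sets G ?F \<subseteq> T"
    proof
      fix A assume "A \<in> end_sets G ?F"
      then obtain B where AB: "A \<in> left_commensurated G" "B \<in> T"
        and "near_equal G `` {A} = near_equal G `` {B}"
        by (auto simp: end_sets_def)
      then have "(A, B) \<in> near_equal G"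
        using T(1) eq_equiv_class_iff[OF equiv_near_equal] by blast
      with AB show "A \<in> T"
        using up by (simp add: near_equal_def)
    qed
  qed
  have "order_filter (ends_algebra G) ?F"
    unfolding order_filter_ends_algebra_iff[OF F] es
  proof (intro conjI ballI impI)
    show "T \<noteq> {}"
      using T(2) by blast
    show "B \<in> T" if "A \<in> T" "B \<in> left_commensurated G" "finite (A - B)" for A B
      using up that by blast
    show "\<exists>C\<in>T. finite (C - A) \<and> finite (C - B)" if "A \<in> T" "B \<in> T" for A B
      by (rule bexI[OF _ Int[OF that]]) (simp add: Int_Diff Diff_eq_empty_iff[THEN iffD2])
  qed
  then show "proper_filter (ends_algebra G) ?F"
    using proper_filter_ends_algebra_iff[OF _ left_commensurated_empty] es T(3)
    by (simp add: proper_filter_def)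
qed

context
  fixes U assumes U: "U \<in> ultrafilters (ends_algebra G)"
begin

lemma ultrafilter_subset: "U \<subseteq> carrier (ends_algebra G)"
  and ultrafilter_order_filter: "order_filter (ends_algebra G) U"
  using U by (simp_all add: ultrafilters_def proper_filter_def order_filter_def)

lemma end_sets_upward:
  assumes "A \<in> end_sets G U" "B \<in> left_commensurated G" "finite (A - B)"
  shows "B \<in> end_sets G U"
  using ultrafilter_order_filter assms
  unfolding order_filter_ends_algebra_iff[OF ultrafilter_subset] by blast

lemma end_sets_Int:
  assumes "A \<in> end_sets G U" "B \<in> end_sets G U"
  shows "A \<inter> B \<in> end_sets G U"
proof -
  obtain C where C: "C \<in> end_sets G U" "finite (C - A)" "finite (C - B)"
    using ultrafilter_order_filter assms
    unfolding order_filter_ends_algebra_iff[OF ultrafilter_subset] by blast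
  moreover have "C - A \<inter> B = (C - A) \<union> (C - B)"
    by auto
  ultimately show ?thesis
    using assms by (intro end_sets_upward[OF C(1)])
      (auto simp: left_commensurated_Int end_sets_def)
qed

lemma empty_notin_end_sets: "{} \<notin> end_sets G U"
  using U proper_filter_ends_algebra_iff[OF ultrafilter_order_filter left_commensurated_empty]
  by (simp add: ultrafilters_def proper_filter_def)

lemma end_sets_infinite:
  assumes "A \<in> end_sets G U" shows "infinite A"
  using end_sets_upward[OF assms left_commensurated_empty] empty_notin_end_sets by auto

lemma carrier_in_end_sets: "carrier G \<in> end_sets G U"
proof -
  obtain A where A: "A \<in> end_sets G U"
    using ultrafilter_order_filter
    unfolding order_filter_ends_algebra_iff[OF ultrafilter_subset] by blast
  then have "A - carrier G = {}"
    by (auto simp: end_sets_def left_commensurated_iff)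
  then show ?thesis
    by (intro end_sets_upward[OF A left_commensurated_carrier]) (simp only: finite.emptyI)
qed

text \<open>If \<open>A\<close> is not in the end, then the complement of \<open>A\<close> can be adjoined to it without producing a
  finite set. Maximality forces the complement to be in the end already.\<close>

lemma end_sets_prime:
  assumes A: "A \<in> left_commensurated G" and notin: "A \<notin> end_sets G U"
  shows "carrier G - A \<in> end_sets G U"
proof -
  \<comment> \<open>the filter generated by the end and the complement of \<open>A\<close>\<close>
  define T where "T = {C \<in> left_commensurated G. \<exists>B\<in>end_sets G U. finite (B - A - C)}"
  define F where "F = (\<lambda>C. near_equal G `` {C}) ` T"
  have T_lc: "T \<subseteq> left_commensurated G"
    by (auto simp: T_def)
  have T_carrier: "carrier G \<in> T"
  proof -
    have "carrier G - A - carrier G = {}"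
      by auto
    then show ?thesis
      using carrier_in_end_sets left_commensurated_carrier unfolding T_def
      by (metis (no_types, lifting) finite.emptyI mem_Collect_eq)
  qed
  have T_empty: "{} \<notin> T"
    using notin end_sets_upward[OF _ A] by (auto simp: T_def)
  have T_up: "C \<in> T" if "D \<in> T" "C \<in> left_commensurated G" "finite (D - C)" for C D
  proof -
    obtain B where B: "B \<in> end_sets G U" "finite (B - A - D)"
      using \<open>D \<in> T\<close> by (auto simp: T_def)
    have "finite ((B - A - D) \<union> (D - C))"
      using B that by simp
    then have "finite (B - A - C)"
      by (rule finite_subset[rotated]) auto
    with B that show ?thesis
      by (auto simp: T_def)
  qed
  have T_Int: "C \<inter> D \<in> T" if CD: "C \<in> T" "D \<in> T" for C D
  proof -
    obtain B B' where B: "B \<in> end_sets G U" "finite (B - A - C)"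
      "B' \<in> end_sets G U" "finite (B' - A - D)"
      using CD by (auto simp: T_def)
    have "finite ((B - A - C) \<union> (B' - A - D))"
      using B by simp
    then have "finite (B \<inter> B' - A - (C \<inter> D))"
      by (rule finite_subset[rotated]) auto
    then show ?thesis
      using CD end_sets_Int[OF B(1,3)] by (auto simp: T_def left_commensurated_Int)
  qed
  have T: "end_sets G F = T" and "proper_filter (ends_algebra G) F"
    unfolding F_def
    using end_sets_filter_of_left_commensurated proper_filter_of_left_commensurated
      T_lc T_carrier T_empty T_up T_Int by blast+
  moreover have "U \<subseteq> F"
  proof
    fix x assume "x \<in> U"
    then obtain B where "B \<in> left_commensurated G" "x = near_equal G `` {B}"
      using ultrafilter_subset by (auto simp: carrier_ends_algebra)
    with \<open>x \<in> U\<close> have "B \<in> end_sets G U" "B \<in> left_commensurated G"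
      by (auto simp: end_sets_def)
    moreover have "B - A - B = {}"
      by auto
    ultimately have "B \<in> T"
      unfolding T_def by (metis (no_types, lifting) finite.emptyI mem_Collect_eq)
    then show "x \<in> F"
      using \<open>x = _\<close> by (simp add: F_def)
  qed
  ultimately have "F = U"
    using U by (simp add: ultrafilters_def)
  moreover have "carrier G - A \<in> T"
    using left_commensurated_Compl[OF A] carrier_in_end_sets unfolding T_def
    by (intro CollectI conjI bexI[of _ "carrier G"]) simp_all
  ultimately show ?thesis
    using T by simp
qed

end

lemma ultrafilters_eqI:
  assumes "U \<in> ultrafilters (ends_algebra G)" "V \<in> ultrafilters (ends_algebra G)"
    and "end_sets G U = end_sets G V"
  shows "U = V"
proof -
  have *: "W = (\<lambda>A. near_equal G `` {A}) ` end_sets G W" if "W \<in> ultrafilters (ends_algebra G)" for W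
    using ultrafilter_subset[OF that] by (auto simp: carrier_ends_algebra end_sets_def)
  show ?thesis
    using *[OF assms(1)] *[OF assms(2)] assms(3) by simp
qed

lemma end_sets_Inter:
  assumes U: "U \<in> ultrafilters (ends_algebra G)"
    and "finite \<A>" "\<A> \<subseteq> end_sets G U"
  shows "carrier G \<inter> \<Inter>\<A> \<in> end_sets G U"
  using assms(2,3)
proof (induction \<A> rule: finite_induct)
  case empty
  then show ?case
    by (simp add: carrier_in_end_sets[OF U])
next
  case (insert A \<A>)
  then have "A \<inter> (carrier G \<inter> \<Inter>\<A>) \<in> end_sets G U"
    using end_sets_Int[OF U, of A "carrier G \<inter> \<Inter>\<A>"] by simp
  moreover have "A \<inter> (carrier G \<inter> \<Inter>\<A>) = carrier G \<inter> \<Inter>(insert A \<A>)"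
    by auto
  ultimately show ?case
    by simp
qed

text \<open>The proper filters containing the one generated by \<open>\<A>\<close> are closed under unions of nonempty
  chains, because improperness would already show in one member: it means containing the bottom
  element. Zorn's lemma then gives a maximal one.\<close>

lemma ultrafilter_extending:
  assumes lc: "\<A> \<subseteq> left_commensurated G"
    and fip: "\<And>\<F>. finite \<F> \<Longrightarrow> \<F> \<subseteq> \<A> \<Longrightarrow> infinite (carrier G \<inter> \<Inter>\<F>)"
  obtains U where "U \<in> ultrafilters (ends_algebra G)" "\<A> \<subseteq> end_sets G U"
proof -
  define T where
    "T = {C \<in> left_commensurated G. \<exists>\<F>. finite \<F> \<and> \<F> \<subseteq> \<A> \<and> finite (carrier G \<inter> \<Inter>\<F> - C)}"
  define F0 where "F0 = (\<lambda>C. near_equal G `` {C}) ` T"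
  have T_A: "\<A> \<subseteq> T"
  proof
    fix A assume "A \<in> \<A>"
    moreover have "carrier G \<inter> \<Inter>{A} - A = {}"
      by auto
    then have "finite (carrier G \<inter> \<Inter>{A} - A)"
      by (simp only: finite.emptyI)
    ultimately show "A \<in> T"
      using lc unfolding T_def by (intro CollectI conjI exI[of _ "{A}"]) auto
  qed
  have T_lc: "T \<subseteq> left_commensurated G"
    by (auto simp: T_def)
  have T_carrier: "carrier G \<in> T"
    by (auto simp: T_def left_commensurated_carrier intro!: exI[of _ "{}"])
  have T_empty: "{} \<notin> T"
    using fip by (auto simp: T_def)
  have T_up: "D \<in> T" if CD: "C \<in> T" "D \<in> left_commensurated G" "finite (C - D)" for C D
  proof -
    obtain \<F> where \<F>: "finite \<F>" "\<F> \<subseteq> \<A>" "finite (carrier G \<inter> \<Inter>\<F> - C)"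
      using CD(1) unfolding T_def by (elim CollectE conjE exE)
    have "finite ((carrier G \<inter> \<Inter>\<F> - C) \<union> (C - D))"
      using \<F>(3) CD(3) by (rule finite_UnI)
    then have "finite (carrier G \<inter> \<Inter>\<F> - D)"
      by (rule finite_subset[rotated]) auto
    with \<F>(1,2) CD(2) show ?thesis
      unfolding T_def by (intro CollectI conjI exI[of _ \<F>])
  qed
  have T_Int: "C \<inter> D \<in> T" if CD: "C \<in> T" "D \<in> T" for C D
  proof -
    obtain \<F> where \<F>: "finite \<F>" "\<F> \<subseteq> \<A>" "finite (carrier G \<inter> \<Inter>\<F> - C)"
      using CD(1) unfolding T_def by (elim CollectE conjE exE)
    obtain \<F>' where \<F>': "finite \<F>'" "\<F>' \<subseteq> \<A>" "finite (carrier G \<inter> \<Inter>\<F>' - D)"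
      using CD(2) unfolding T_def by (elim CollectE conjE exE)
    have "finite ((carrier G \<inter> \<Inter>\<F> - C) \<union> (carrier G \<inter> \<Inter>\<F>' - D))"
      using \<F>(3) \<F>'(3) by (rule finite_UnI)
    then have "finite (carrier G \<inter> \<Inter>(\<F> \<union> \<F>') - (C \<inter> D))"
      by (rule finite_subset[rotated]) auto
    then show ?thesis
      using CD \<F>(1,2) \<F>'(1,2) left_commensurated_Int unfolding T_def
      by (intro CollectI conjI exI[of _ "\<F> \<union> \<F>'"]) auto
  qed
  have F0: "end_sets G F0 = T" "proper_filter (ends_algebra G) F0"
    unfolding F0_def
    using end_sets_filter_of_left_commensurated proper_filter_of_left_commensurated
      T_lc T_carrier T_empty T_up T_Int by blast+
  define \<P> where "\<P> = {F. proper_filter (ends_algebra G) F \<and> F0 \<subseteq> F}"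
  have bottom: "near_equal G `` {{}} \<notin> F" if "F \<in> \<P>" for F
    using that proper_filter_ends_algebra_iff[of G F, OF _ left_commensurated_empty]
    by (auto simp: \<P>_def proper_filter_def end_sets_def left_commensurated_empty)
  have "\<exists>M\<in>\<P>. \<forall>X\<in>\<P>. M \<subseteq> X \<longrightarrow> X = M"
  proof (rule subset_Zorn_nonempty)
    show "\<P> \<noteq> {}"
      using F0 by (auto simp: \<P>_def)
    fix \<C> assume ne: "\<C> \<noteq> {}" and chain: "subset.chain \<P> \<C>"
    have of: "order_filter (ends_algebra G) F" "F0 \<subseteq> F" "F \<in> \<P>" if "F \<in> \<C>" for F
      using chain that by (auto simp: subset_chain_def \<P>_def proper_filter_def)
    have "order_filter (ends_algebra G) (\<Union>\<C>)"
      unfolding order_filter_def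
    proof (intro conjI ballI impI)
      show "\<Union>\<C> \<subseteq> carrier (ends_algebra G)" "\<Union>\<C> \<noteq> {}"
        using of(1) ne unfolding order_filter_def by blast+
      show "y \<in> \<Union>\<C>" if "x \<in> \<Union>\<C>" "y \<in> carrier (ends_algebra G)" "x \<sqsubseteq>\<^bsub>ends_algebra G\<^esub> y" for x y
        using of(1) that unfolding order_filter_def by blast
      fix x y assume "x \<in> \<Union>\<C>" "y \<in> \<Union>\<C>"
      then obtain F where "F \<in> \<C>" "x \<in> F" "y \<in> F"
        using chain unfolding subset_chain_def by blast
      then show "\<exists>z\<in>\<Union>\<C>. z \<sqsubseteq>\<^bsub>ends_algebra G\<^esub> x \<and> z \<sqsubseteq>\<^bsub>ends_algebra G\<^esub> y"
        using of(1) unfolding order_filter_def by blast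
    qed
    moreover have "near_equal G `` {{}} \<in> carrier (ends_algebra G)" "near_equal G `` {{}} \<notin> \<Union>\<C>"
      using bottom of(3) left_commensurated_empty by (auto simp: carrier_ends_algebra)
    ultimately show "\<Union>\<C> \<in> \<P>"
      using of(2) ne by (auto simp: \<P>_def proper_filter_def)
  qed
  then obtain U where U: "U \<in> \<P>" "\<And>F. F \<in> \<P> \<Longrightarrow> U \<subseteq> F \<Longrightarrow> F = U"
    by blast
  show thesis
  proof
    show "U \<in> ultrafilters (ends_algebra G)"
      using U by (auto simp: ultrafilters_def \<P>_def)
    show "\<A> \<subseteq> end_sets G U"
      using U(1) T_A F0(1) by (auto simp: \<P>_def end_sets_def)
  qed
qed

section \<open>The topology of the space of ends\<close>

lemma topspace_space_of_ends: "topspace (space_of_ends G) = ultrafilters (ends_algebra G)"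
  by (simp add: space_of_ends_def topspace_stone_dual)

definition ends_within :: "'a set \<Rightarrow> 'a set set set set" where
  "ends_within A = {U \<in> ultrafilters (ends_algebra G). A \<in> end_sets G U}"

lemma openin_ends_within:
  assumes "A \<in> left_commensurated G"
  shows "openin (space_of_ends G) (ends_within A)"
proof -
  have "ends_within A = {U \<in> ultrafilters (ends_algebra G). near_equal G `` {A} \<in> U}"
    using assms by (simp add: ends_within_def end_sets_def)
  with assms show ?thesis
    unfolding space_of_ends_def stone_dual_def
    by (intro topology_generated_by_Basis) (auto simp: carrier_ends_algebra)
qed

lemma ends_within_Compl:
  assumes "A \<in> left_commensurated G"
  shows "ends_within (carrier G - A) = topspace (space_of_ends G) - ends_within A"
proof -
  have False if "U \<in> ultrafilters (ends_algebra G)" "A \<in> end_sets G U" "carrier G - A \<in> end_sets G U" for U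
    using end_sets_Int[OF that] empty_notin_end_sets[OF that(1)] by simp
  then show ?thesis
    using end_sets_prime assms by (auto simp: ends_within_def topspace_space_of_ends)
qed

text \<open>The generating sets already form a base, since an end is closed under intersections.\<close>

lemma ends_within_base:
  assumes "openin (space_of_ends G) W" "U \<in> W"
  obtains A where "A \<in> end_sets G U" "ends_within A \<subseteq> W"
proof -
  have "\<exists>A\<in>end_sets G U. ends_within A \<subseteq> W"
    if "generate_topology_on ((\<lambda>a. {U \<in> ultrafilters (ends_algebra G). a \<in> U}) ` carrier (ends_algebra G)) W"
      "U \<in> W" "U \<in> ultrafilters (ends_algebra G)"
    using that
  proof (induction rule: generate_topology_on.induct)
    case (Int V W)
    then obtain A B where "A \<in> end_sets G U" "ends_within A \<subseteq> V" "B \<in> end_sets G U" "ends_within B \<subseteq> W"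
      by blast
    moreover have "ends_within (A \<inter> B) \<subseteq> ends_within A \<inter> ends_within B"
      using calculation
      by (auto simp: ends_within_def end_sets_subset[THEN subsetD] Diff_eq_empty_iff[THEN iffD2] intro: end_sets_upward)
    ultimately show ?case
      using end_sets_Int[OF Int.prems(2)] by (meson Int_mono order_trans)
  next
    case (UN K)
    then show ?case
      by (meson UnionE Union_upper order_trans)
  next
    case (Basis S)
    then show ?case
      by (auto simp: carrier_ends_algebra ends_within_def end_sets_def)
  qed simp
  moreover have "U \<in> ultrafilters (ends_algebra G)"
    using openin_subset[OF assms(1)] assms(2) by (auto simp: topspace_space_of_ends)
  ultimately show thesis
    using assms that
    unfolding space_of_ends_def stone_dual_def openin_topology_generated_by_iff by blast
qed

text \<open>Given a cover without finite subcover, consider the complements of all \<open>A\<close> such that \<open>ends_within A\<close>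
  lies in a member of the cover. No finite intersection of them is finite, as otherwise finitely
  many of the \<open>ends_within A\<close> would cover the space. So some end contains all these complements, and
  that end is not covered.\<close>

lemma compact_space_of_ends: "compact_space (space_of_ends G)"
  unfolding compact_space_alt
proof (intro allI impI)
  fix \<U> assume "(\<forall>V\<in>\<U>. openin (space_of_ends G) V) \<and> topspace (space_of_ends G) \<subseteq> \<Union>\<U>"
  then have opn: "\<And>V. V \<in> \<U> \<Longrightarrow> openin (space_of_ends G) V" and cover: "topspace (space_of_ends G) \<subseteq> \<Union>\<U>"
    by auto
  define S where "S = {A \<in> left_commensurated G. \<exists>V\<in>\<U>. ends_within A \<subseteq> V}"
  show "\<exists>\<F>. finite \<F> \<and> \<F> \<subseteq> \<U> \<and> topspace (space_of_ends G) \<subseteq> \<Union>\<F>"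
  proof (rule ccontr)
    assume no: "\<not> ?thesis"
    have fip: "infinite (carrier G \<inter> \<Inter>\<F>)" if \<F>: "finite \<F>" "\<F> \<subseteq> (\<lambda>A. carrier G - A) ` S" for \<F>
    proof
      assume fin: "finite (carrier G \<inter> \<Inter>\<F>)"
      obtain S' where S': "finite S'" "S' \<subseteq> S" "\<F> = (\<lambda>A. carrier G - A) ` S'"
        using \<F> by (meson finite_subset_image)
      have "\<exists>A\<in>S'. U \<in> ends_within A" if U: "U \<in> ultrafilters (ends_algebra G)" for U
      proof (rule ccontr)
        assume "\<not> ?thesis"
        then have "\<F> \<subseteq> end_sets G U"
          using S' end_sets_prime[OF U] U by (auto simp: S_def ends_within_def)
        then show False
          using end_sets_Inter[OF U \<F>(1)] end_sets_infinite[OF U] fin by blast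
      qed
      moreover have "\<forall>A\<in>S'. \<exists>V. V \<in> \<U> \<and> ends_within A \<subseteq> V"
        using S'(2) by (auto simp: S_def)
      then obtain V where "\<forall>A\<in>S'. V A \<in> \<U> \<and> ends_within A \<subseteq> V A"
        by (rule bchoice[THEN exE])
      ultimately have "topspace (space_of_ends G) \<subseteq> \<Union>(V ` S')" "V ` S' \<subseteq> \<U>"
        unfolding topspace_space_of_ends by blast+
      with no S'(1) show False
        by blast
    qed
    have lc: "(\<lambda>A. carrier G - A) ` S \<subseteq> left_commensurated G"
      by (auto simp: S_def left_commensurated_Compl)
    obtain U where U: "U \<in> ultrafilters (ends_algebra G)" "(\<lambda>A. carrier G - A) ` S \<subseteq> end_sets G U"
      using lc fip by (rule ultrafilter_extending)
    then obtain V where V: "V \<in> \<U>" "U \<in> V"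
      using cover by (auto simp: topspace_space_of_ends)
    obtain A where A: "A \<in> end_sets G U" "ends_within A \<subseteq> V"
      using ends_within_base[OF opn[OF V(1)] V(2)] by blast
    then have "A \<in> S"
      using V end_sets_subset by (auto simp: S_def)
    then have "A \<inter> (carrier G - A) \<in> end_sets G U"
      using U A by (intro end_sets_Int) auto
    then show False
      using empty_notin_end_sets[OF U(1)] by simp
  qed
qed

text \<open>The membership predicates of the countably many commensurated sets embed the space into a
  countable product of two-point spaces.\<close>

lemma metrizable_space_of_ends_if_countable:
  assumes "countable (left_commensurated G)"
  shows "metrizable_space (space_of_ends G)"
proof -
  let ?E = "space_of_ends G"
  let ?P = "product_topology (\<lambda>_. discrete_topology (UNIV :: bool set)) (left_commensurated G)"
  define q where "q U = (\<lambda>A\<in>left_commensurated G. A \<in> end_sets G U)" for U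
  have "continuous_map ?E (discrete_topology UNIV) (\<lambda>U. A \<in> end_sets G U)"
    if A: "A \<in> left_commensurated G" for A
    unfolding continuous_map_def
  proof (intro conjI allI impI)
    fix S :: "bool set"
    have "{U \<in> topspace ?E. (A \<in> end_sets G U) \<in> S} =
        (if True \<in> S then ends_within A else {}) \<union> (if False \<in> S then topspace ?E - ends_within A else {})"
      by (auto simp: ends_within_def topspace_space_of_ends) (metis (full_types))+
    moreover have "openin ?E (ends_within A)" "openin ?E (topspace ?E - ends_within A)"
      using openin_ends_within[OF A] openin_ends_within[OF left_commensurated_Compl[OF A]]
      by (simp_all add: ends_within_Compl[OF A])
    ultimately show "openin ?E {U \<in> topspace ?E. (A \<in> end_sets G U) \<in> S}"
      by auto
  qed simp
  then have "continuous_map ?E ?P q"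
    by (auto simp: continuous_map_componentwise q_def image_subset_iff)
  moreover have "inj_on q (topspace ?E)"
  proof (rule inj_onI)
    fix U V assume "U \<in> topspace ?E" "V \<in> topspace ?E" "q U = q V"
    moreover have "A \<in> end_sets G U \<longleftrightarrow> A \<in> end_sets G V" for A
    proof (cases "A \<in> left_commensurated G")
      case True
      with fun_cong[OF \<open>q U = q V\<close>, of A] show ?thesis
        by (simp add: q_def)
    qed (use end_sets_subset in blast)
    then have "end_sets G U = end_sets G V"
      by blast
    ultimately show "U = V"
      by (intro ultrafilters_eqI) (simp_all add: topspace_space_of_ends)
  qed
  moreover have "Hausdorff_space ?P"
    by (simp add: Hausdorff_space_product_topology)
  ultimately have "embedding_map ?E ?P q"
    using compact_space_of_ends by (intro continuous_imp_embedding_map)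
  then have "?E homeomorphic_space subtopology ?P (q ` topspace ?E)"
    by (rule embedding_map_imp_homeomorphic_space)
  moreover have "metrizable_space ?P"
    using assms by (auto simp: metrizable_space_product_topology elim: countable_subset[rotated])
  ultimately show ?thesis
    using homeomorphic_metrizable_space metrizable_space_subtopology by blast
qed

section \<open>Limits of almost invariant functions along an end\<close>

text \<open>The filter on the set \<open>G\<close> that has the members of the end as a base. It need not be an
  ultrafilter on \<open>G\<close>, but it decides every almost invariant predicate (\<open>end_filter_ultra\<close>).\<close>

definition end_filter :: "'a set set set \<Rightarrow> 'a filter" where
  "end_filter U = (INF A\<in>end_sets G U. principal A)"

context
  fixes U assumes U: "U \<in> ultrafilters (ends_algebra G)"
begin

lemma eventually_end_filter: "eventually P (end_filter U) \<longleftrightarrow> (\<exists>A\<in>end_sets G U. \<forall>h\<in>A. P h)"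
  unfolding end_filter_def
  by (subst eventually_INF_base)
    (use carrier_in_end_sets[OF U] end_sets_Int[OF U] in \<open>auto simp: eventually_principal\<close>)

lemma end_filter_nontrivial: "end_filter U \<noteq> bot"
proof -
  have "A \<noteq> {}" if "A \<in> end_sets G U" for A
    using that empty_notin_end_sets[OF U] by blast
  then show ?thesis
    unfolding trivial_limit_def eventually_end_filter by blast
qed

lemma eventually_end_filter_carrier: "eventually (\<lambda>h. h \<in> carrier G) (end_filter U)"
  using carrier_in_end_sets[OF U] by (auto simp: eventually_end_filter)

lemma eventually_end_filter_iff:
  assumes "left_almost_invariant G P"
  shows "eventually P (end_filter U) \<longleftrightarrow> {h \<in> carrier G. P h} \<in> end_sets G U"
proof
  assume "eventually P (end_filter U)"
  then obtain A where A: "A \<in> end_sets G U" "\<forall>h\<in>A. P h"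
    by (auto simp: eventually_end_filter)
  then have "A \<subseteq> carrier G"
    by (simp add: end_sets_def left_commensurated_iff)
  with A have "A - {h \<in> carrier G. P h} = {}"
    by blast
  then show "{h \<in> carrier G. P h} \<in> end_sets G U"
    using end_sets_upward[OF U A(1) left_commensurated_Collect[OF assms]] by (simp only: finite.emptyI)
next
  assume "{h \<in> carrier G. P h} \<in> end_sets G U"
  then show "eventually P (end_filter U)"
    unfolding eventually_end_filter by (rule bexI[rotated]) blast
qed

lemma end_filter_ultra:
  assumes "left_almost_invariant G P"
  shows "eventually P (end_filter U) \<or> eventually (\<lambda>h. \<not> P h) (end_filter U)"
proof -
  have "left_almost_invariant G (\<lambda>h. \<not> P h)"
    using assms by (rule left_almost_invariant_compose)
  moreover have "{h \<in> carrier G. \<not> P h} = carrier G - {h \<in> carrier G. P h}"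
    by blast
  ultimately show ?thesis
    using end_sets_prime[OF U left_commensurated_Collect[OF assms]]
    by (auto simp: eventually_end_filter_iff assms)
qed

text \<open>By compactness the image filter has a cluster point. Each neighbourhood of that point pulls back
  to an almost invariant predicate, which the filter decides, so the cluster point is a limit.\<close>

lemma end_filter_convergent:
  fixes \<phi> :: "'a \<Rightarrow> 'c :: t2_space"
  assumes \<phi>: "left_almost_invariant G \<phi>" and K: "compact K" "\<phi> ` carrier G \<subseteq> K"
  obtains l where "l \<in> K" "(\<phi> \<longlongrightarrow> l) (end_filter U)"
proof -
  have "eventually (\<lambda>x. x \<in> K) (filtermap \<phi> (end_filter U))"
    unfolding eventually_filtermap
    by (rule eventually_mono[OF eventually_end_filter_carrier]) (use K in auto)
  moreover have "filtermap \<phi> (end_filter U) \<noteq> bot"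
    by (simp add: filtermap_bot_iff end_filter_nontrivial)
  ultimately obtain l where l: "l \<in> K" "inf (nhds l) (filtermap \<phi> (end_filter U)) \<noteq> bot"
    using K(1) unfolding compact_filter by blast
  have "eventually (\<lambda>h. \<phi> h \<in> S) (end_filter U)" if S: "open S" "l \<in> S" for S
  proof (rule ccontr)
    assume "\<not> ?thesis"
    then have "eventually (\<lambda>x. x \<notin> S) (filtermap \<phi> (end_filter U))"
      using end_filter_ultra[OF left_almost_invariant_compose[OF \<phi>, of "\<lambda>x. x \<in> S"]]
      by (simp add: eventually_filtermap)
    moreover have "eventually (\<lambda>x. x \<in> S) (nhds l)"
      using S by (auto simp: eventually_nhds)
    ultimately have "eventually (\<lambda>x. False) (inf (nhds l) (filtermap \<phi> (end_filter U)))"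
      unfolding eventually_inf by blast
    with l(2) show False
      by (simp add: trivial_limit_def)
  qed
  then have "(\<phi> \<longlongrightarrow> l) (end_filter U)"
    by (simp add: tendsto_def)
  with l(1) show thesis
    by (rule that)
qed

lemma tendsto_Lim_end_filter:
  fixes \<phi> :: "'a \<Rightarrow> 'c :: t2_space"
  assumes "left_almost_invariant G \<phi>" "compact K" "\<phi> ` carrier G \<subseteq> K"
  shows "Lim (end_filter U) \<phi> \<in> K" "(\<phi> \<longlongrightarrow> Lim (end_filter U) \<phi>) (end_filter U)"
proof -
  obtain l where "l \<in> K" "(\<phi> \<longlongrightarrow> l) (end_filter U)"
    using end_filter_convergent[OF assms] by blast
  moreover from this have "Lim (end_filter U) \<phi> = l"
    by (intro tendsto_Lim end_filter_nontrivial)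
  ultimately show "Lim (end_filter U) \<phi> \<in> K" "(\<phi> \<longlongrightarrow> Lim (end_filter U) \<phi>) (end_filter U)"
    by simp_all
qed

end

text \<open>If \<open>\<phi>\<close> is eventually in a closed ball along \<open>U\<close>, then the set of points where it is in that ball
  belongs to \<open>U\<close>, and the limits along all ends containing this set stay in the ball.\<close>

lemma continuous_map_Lim_end_filter:
  fixes \<phi> :: "'a \<Rightarrow> 'c :: metric_space"
  assumes \<phi>: "left_almost_invariant G \<phi>" and K: "compact K" "\<phi> ` carrier G \<subseteq> K"
  shows "continuous_map (space_of_ends G) (top_of_set K) (\<lambda>U. Lim (end_filter U) \<phi>)"
proof -
  let ?L = "\<lambda>U. Lim (end_filter U) \<phi>"
  have "openin (space_of_ends G) {U \<in> topspace (space_of_ends G). ?L U \<in> V}" if V: "open V" for V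
  proof (subst openin_subopen, intro ballI)
    fix U assume "U \<in> {U \<in> topspace (space_of_ends G). ?L U \<in> V}"
    then have U: "U \<in> ultrafilters (ends_algebra G)" "?L U \<in> V"
      by (auto simp: topspace_space_of_ends)
    obtain e where e: "e > 0" "cball (?L U) e \<subseteq> V"
      using V U(2) open_contains_cball by blast
    define A where "A = {h \<in> carrier G. \<phi> h \<in> cball (?L U) e}"
    have inv: "left_almost_invariant G (\<lambda>h. \<phi> h \<in> cball (?L U) e)"
      using \<phi> by (rule left_almost_invariant_compose)
    have "eventually (\<lambda>h. \<phi> h \<in> ball (?L U) e) (end_filter U)"
      by (rule topological_tendstoD[OF tendsto_Lim_end_filter(2)[OF U(1) \<phi> K]]) (use e(1) in auto)
    then have "eventually (\<lambda>h. \<phi> h \<in> cball (?L U) e) (end_filter U)"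
      by (rule eventually_mono) auto
    then have "U \<in> ends_within A"
      using eventually_end_filter_iff[OF U(1) inv] U(1) by (simp add: ends_within_def A_def)
    moreover have "openin (space_of_ends G) (ends_within A)"
      unfolding A_def by (intro openin_ends_within left_commensurated_Collect inv)
    moreover have "ends_within A \<subseteq> {U \<in> topspace (space_of_ends G). ?L U \<in> V}"
    proof
      fix U' assume "U' \<in> ends_within A"
      then have U': "U' \<in> ultrafilters (ends_algebra G)" "A \<in> end_sets G U'"
        by (auto simp: ends_within_def)
      then have "eventually (\<lambda>h. \<phi> h \<in> cball (?L U) e) (end_filter U')"
        using eventually_end_filter_iff[OF U'(1) inv] by (simp add: A_def)
      then have "?L U' \<in> cball (?L U) e"
        using closed_cball end_filter_nontrivial[OF U'(1)] tendsto_Lim_end_filter(2)[OF U'(1) \<phi> K]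
        by (intro Lim_in_closed_set[of "cball (?L U) e" \<phi> "end_filter U'"])
      with e U' show "U' \<in> {U \<in> topspace (space_of_ends G). ?L U \<in> V}"
        by (auto simp: topspace_space_of_ends)
    qed
    ultimately show "\<exists>T. openin (space_of_ends G) T \<and> U \<in> T \<and>
        T \<subseteq> {U \<in> topspace (space_of_ends G). ?L U \<in> V}"
      by blast
  qed
  then have "continuous_map (space_of_ends G) euclidean ?L"
    by (simp add: continuous_map_def)
  moreover have "?L U \<in> K" if "U \<in> topspace (space_of_ends G)" for U
    using tendsto_Lim_end_filter(1)[OF _ \<phi> K] that by (simp add: topspace_space_of_ends)
  ultimately show ?thesis
    by (simp add: continuous_map_in_subtopology Pi_iff)
qed

end

section \<open>The Stone-Cech compactification of the natural numbers\<close>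

text \<open>Unit in the sense of the adjunction: the canonical map of a space into its compactification.\<close>

definition stone_cech_unit :: "'a topology \<Rightarrow> 'a \<Rightarrow> ('a \<Rightarrow> real) \<Rightarrow> real" where
  "stone_cech_unit X x = (\<lambda>\<phi>\<in>unit_functions X. \<phi> x)"

definition unit_cube :: "'a topology \<Rightarrow> (('a \<Rightarrow> real) \<Rightarrow> real) topology" where
  "unit_cube X = product_topology (\<lambda>\<phi>. top_of_set {0..1}) (unit_functions X)"

lemma stone_cech_eq:
  "stone_cech X = subtopology (unit_cube X) (unit_cube X closure_of (stone_cech_unit X ` topspace X))"
  by (simp add: stone_cech_def unit_cube_def stone_cech_unit_def[abs_def] Let_def)

lemma topspace_stone_cech:
  "topspace (stone_cech X) = unit_cube X closure_of (stone_cech_unit X ` topspace X)"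
  unfolding stone_cech_eq topspace_subtopology by (rule Int_absorb1[OF closure_of_subset_topspace])

lemma stone_cech_unit_in_cube:
  assumes "x \<in> topspace X"
  shows "stone_cech_unit X x \<in> topspace (unit_cube X)"
proof -
  have "\<phi> x \<in> {0..1}" if "\<phi> \<in> unit_functions X" for \<phi>
    using that assms continuous_map_image_subset_topspace[of X "top_of_set {0..1}" \<phi>]
    by (auto simp: unit_functions_def)
  then show ?thesis
    by (simp add: stone_cech_unit_def unit_cube_def)
qed

lemma stone_cech_unit_in_topspace:
  assumes "x \<in> topspace X"
  shows "stone_cech_unit X x \<in> topspace (stone_cech X)"
proof -
  have "stone_cech_unit X ` topspace X \<subseteq> topspace (unit_cube X)"
    by (intro image_subsetI stone_cech_unit_in_cube)
  then have "stone_cech_unit X ` topspace X \<subseteq> topspace (stone_cech X)"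
    unfolding topspace_stone_cech by (rule closure_of_subset)
  with assms show ?thesis
    by blast
qed

lemma unit_functions_discrete:
  "unit_functions (discrete_topology (UNIV :: 'a set)) = {\<phi>. range \<phi> \<subseteq> {0..1}}"
  by (auto simp: unit_functions_def)

lemma limitin_imp_in_closure_of:
  assumes "limitin X f l F" "F \<noteq> bot" "eventually (\<lambda>x. f x \<in> S) F"
  shows "l \<in> X closure_of S"
  unfolding in_closure_of
proof (intro conjI allI impI)
  show "l \<in> topspace X"
    using assms(1) by (rule limitin_topspace)
  fix T assume "l \<in> T \<and> openin X T"
  then have "eventually (\<lambda>x. f x \<in> T) F"
    using assms(1) by (auto simp: limitin_def)
  with assms(3) have "eventually (\<lambda>x. f x \<in> S \<and> f x \<in> T) F"
    by (rule eventually_conj)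
  then show "\<exists>y. y \<in> S \<and> y \<in> T"
    using assms(2) by (auto dest: eventually_happens')
qed

text \<open>The indicator function of every second term of the subsequence is one of the coordinates of the
  cube, and it alternates between 0 and 1 along the subsequence.\<close>

lemma no_convergent_subsequence_stone_cech_nat:
  assumes r: "strict_mono r"
  shows "\<not> limitin (stone_cech (discrete_topology (UNIV :: nat set)))
           (stone_cech_unit (discrete_topology UNIV) \<circ> r) l sequentially"
proof
  let ?N = "discrete_topology (UNIV :: nat set)"
  assume lim: "limitin (stone_cech ?N) (stone_cech_unit ?N \<circ> r) l sequentially"
  define \<phi> :: "nat \<Rightarrow> real" where "\<phi> = indicator (r ` {k. even k})"
  have \<phi>: "\<phi> \<in> unit_functions ?N"
    by (auto simp: unit_functions_discrete \<phi>_def indicator_def)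
  have \<phi>_r: "\<phi> (r k) = (if even k then 1 else 0)" for k
    using strict_mono_imp_inj_on[OF r] by (auto simp: \<phi>_def indicator_def inj_def)
  have "limitin (top_of_set {0..1::real}) (\<lambda>k. (stone_cech_unit ?N \<circ> r) k \<phi>) (l \<phi>) sequentially"
    using lim \<phi> unfolding stone_cech_eq limitin_subtopology unit_cube_def limitin_componentwise by blast
  then have lim': "(\<lambda>k. if even k then 1 else 0 :: real) \<longlonglongrightarrow> l \<phi>"
    using \<phi> by (simp add: limitin_subtopology stone_cech_unit_def \<phi>_r)
  have one: "(\<lambda>k. 1 :: real) \<longlonglongrightarrow> l \<phi>"
    using LIMSEQ_subseq_LIMSEQ[OF lim', of "\<lambda>k. 2 * k"] by (simp add: o_def strict_mono_def)
  have zero: "(\<lambda>k. 0 :: real) \<longlonglongrightarrow> l \<phi>"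
    using LIMSEQ_subseq_LIMSEQ[OF lim', of "\<lambda>k. Suc (2 * k)"] by (simp add: o_def strict_mono_def)
  have "l \<phi> = 1" "l \<phi> = 0"
    using LIMSEQ_unique[OF one tendsto_const] LIMSEQ_unique[OF zero tendsto_const] by metis+
  then show False
    by simp
qed

text \<open>Lift the sequence of naturals along the surjection, extract a convergent subsequence upstairs and
  push it down again.\<close>

lemma compact_metrizable_no_map_onto_stone_cech_nat:
  assumes X: "compact_space X" "metrizable_space X"
    and p: "continuous_map X (stone_cech (discrete_topology (UNIV :: nat set))) p"
  shows "p ` topspace X \<noteq> topspace (stone_cech (discrete_topology (UNIV :: nat set)))"
proof
  let ?N = "discrete_topology (UNIV :: nat set)"
  assume surj: "p ` topspace X = topspace (stone_cech ?N)"
  obtain M d where M: "Metric_space M d" and X_eq: "X = Metric_space.mtopology M d"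
    using X(2) by (auto simp: metrizable_space_def)
  interpret Metric_space M d
    by (rule M)
  have "stone_cech_unit ?N n \<in> p ` topspace X" for n
    using stone_cech_unit_in_topspace[of n ?N] surj by simp
  then have "\<exists>x. x \<in> topspace X \<and> p x = stone_cech_unit ?N n" for n
    by (metis imageE)
  then obtain x where x: "\<And>n. x n \<in> topspace X" "\<And>n. p (x n) = stone_cech_unit ?N n"
    by metis
  then have "range x \<subseteq> M"
    by (auto simp: X_eq)
  then obtain l r where r: "strict_mono r" and lim: "limitin X (x \<circ> r) l sequentially"
    using X(1) unfolding X_eq compact_space_sequentially by blast
  have "limitin (stone_cech ?N) (p \<circ> (x \<circ> r)) (p l) sequentially"
    using lim p by (rule continuous_map_limit[rotated])
  moreover have "p \<circ> (x \<circ> r) = stone_cech_unit ?N \<circ> r"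
    by (auto simp: x(2))
  ultimately show False
    using no_convergent_subsequence_stone_cech_nat[OF r] by simp
qed

section \<open>Mapping the ends of an untamely-ended group onto the compactification\<close>

text \<open>A countably infinite image can be identified with the pairs of naturals; projecting to the first component
  makes every fibre infinite, even if the fibres of the original function are finite.\<close>

lemma untamely_ended_infinite_fibres:
  assumes G: "countable (carrier G)" and untame: "\<not> tamely_ended G"
  obtains f :: "'a \<Rightarrow> nat" where "left_almost_invariant G f"
    "\<And>n. infinite {h \<in> carrier G. f h = n}"
proof -
  obtain u :: "'a \<Rightarrow> 'a" where u: "left_almost_invariant G u" "infinite (u ` carrier G)"
    using untame unfolding tamely_ended_def by blast
  define v where "v = (\<lambda>h. prod_decode (to_nat_on (u ` carrier G) (u h)))"
  have "bij_betw (to_nat_on (u ` carrier G)) (u ` carrier G) UNIV"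
    using u(2) G by (simp add: to_nat_on_infinite)
  moreover have "v ` carrier G = prod_decode ` to_nat_on (u ` carrier G) ` u ` carrier G"
    by (simp add: v_def image_image)
  ultimately have v_surj: "v ` carrier G = UNIV"
    using surj_prod_decode by (simp add: bij_betw_def)
  show thesis
  proof
    show "left_almost_invariant G (\<lambda>h. fst (v h))"
      unfolding v_def using u(1) by (rule left_almost_invariant_compose)
    fix n
    have "UNIV \<subseteq> (snd \<circ> v) ` {h \<in> carrier G. fst (v h) = n}"
    proof
      fix m
      have "(n, m) \<in> v ` carrier G"
        using v_surj by simp
      then show "m \<in> (snd \<circ> v) ` {h \<in> carrier G. fst (v h) = n}"
        by (auto simp: image_iff) (metis fst_conv snd_conv)
    qed
    then show "infinite {h \<in> carrier G. fst (v h) = n}"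
      using infinite_UNIV_nat finite_imageI finite_subset by metis
  qed
qed

text \<open>This is the map dual to the embedding of the power set of the naturals into the algebra of ends
  that takes preimages under \<open>f\<close>; infinite fibres make it injective. In coordinates, the image of an
  end is the limit of the canonical image of \<open>f h\<close> as \<open>h\<close> tends to the end. Hence it lies in the closure
  of the naturals, which is the compactification.\<close>

lemma (in group) untamely_ended_map_onto_stone_cech_nat:
  assumes G: "countable (carrier G)" and untame: "\<not> tamely_ended G"
  obtains p where
    "continuous_map (space_of_ends G) (stone_cech (discrete_topology (UNIV :: nat set))) p"
    "p ` topspace (space_of_ends G) = topspace (stone_cech (discrete_topology (UNIV :: nat set)))"
proof -
  let ?N = "discrete_topology (UNIV :: nat set)"
  obtain f :: "'a \<Rightarrow> nat" where f: "left_almost_invariant G f" "\<And>n. infinite {h \<in> carrier G. f h = n}"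
    using untamely_ended_infinite_fibres[OF G untame] by blast
  define p where "p U = (\<lambda>\<phi>\<in>unit_functions ?N. Lim (end_filter U) (\<lambda>h. \<phi> (f h)))" for U
  have inv: "left_almost_invariant G (\<lambda>h. \<phi> (f h))" for \<phi> :: "nat \<Rightarrow> real"
    using f(1) by (rule left_almost_invariant_compose)
  have range: "(\<lambda>h. \<phi> (f h)) ` carrier G \<subseteq> {0..1}" if "\<phi> \<in> unit_functions ?N" for \<phi>
    using that by (auto simp: unit_functions_discrete)
  have compact: "compact {0..1 :: real}"
    by simp
  have cont_cube: "continuous_map (space_of_ends G) (unit_cube ?N) p"
    unfolding unit_cube_def continuous_map_componentwise
  proof (intro conjI ballI)
    show "p ` topspace (space_of_ends G) \<subseteq> extensional (unit_functions ?N)"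
      by (auto simp: p_def)
    fix \<phi> assume \<phi>: "\<phi> \<in> unit_functions ?N"
    then show "continuous_map (space_of_ends G) (top_of_set {0..1}) (\<lambda>U. p U \<phi>)"
      using continuous_map_Lim_end_filter[OF inv[of \<phi>] compact range[OF \<phi>]] by (simp add: p_def)
  qed
  have lim: "limitin (unit_cube ?N) (\<lambda>h. stone_cech_unit ?N (f h)) (p U) (end_filter U)"
    if U: "U \<in> ultrafilters (ends_algebra G)" for U
    unfolding unit_cube_def limitin_componentwise
  proof (intro conjI ballI)
    show "p U \<in> extensional (unit_functions ?N)"
      by (simp add: p_def)
    show "eventually (\<lambda>h. stone_cech_unit ?N (f h) \<in>
        topspace (product_topology (\<lambda>\<phi>. top_of_set {0..1}) (unit_functions ?N))) (end_filter U)"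
      using stone_cech_unit_in_cube[of _ ?N] by (simp add: unit_cube_def)
    fix \<phi> assume \<phi>: "\<phi> \<in> unit_functions ?N"
    have "0 \<le> \<phi> n" "\<phi> n \<le> 1" for n
      using \<phi> by (auto simp: unit_functions_discrete image_subset_iff)
    with \<phi> show "limitin (top_of_set {0..1}) (\<lambda>h. stone_cech_unit ?N (f h) \<phi>) (p U \<phi>) (end_filter U)"
      using tendsto_Lim_end_filter[OF U inv[of \<phi>] compact range[OF \<phi>]]
      by (simp add: limitin_subtopology stone_cech_unit_def p_def)
  qed
  have "p U \<in> topspace (stone_cech ?N)" if "U \<in> topspace (space_of_ends G)" for U
    unfolding topspace_stone_cech
    using that by (intro limitin_imp_in_closure_of[OF lim] end_filter_nontrivial)
      (simp_all add: topspace_space_of_ends)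
  then have cont: "continuous_map (space_of_ends G) (stone_cech ?N) p"
    using cont_cube by (simp add: stone_cech_eq continuous_map_in_subtopology topspace_stone_cech Pi_iff)
  have "stone_cech_unit ?N n \<in> p ` topspace (space_of_ends G)" for n
  proof -
    have fibre: "{h \<in> carrier G. f h = n} \<in> left_commensurated G"
      by (intro left_commensurated_Collect left_almost_invariant_compose[OF f(1)])
    have "infinite (carrier G \<inter> \<Inter>\<F>)" if "\<F> \<subseteq> {{h \<in> carrier G. f h = n}}" for \<F>
    proof -
      have "{h \<in> carrier G. f h = n} \<subseteq> carrier G \<inter> \<Inter>\<F>"
        using that by blast
      then show ?thesis
        using f(2) finite_subset by blast
    qed
    with fibre obtain U where U: "U \<in> ultrafilters (ends_algebra G)"
      and "{h \<in> carrier G. f h = n} \<in> end_sets G U"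
      using ultrafilter_extending[of "{{h \<in> carrier G. f h = n}}"] by auto
    then have ev: "eventually (\<lambda>h. f h = n) (end_filter U)"
      using eventually_end_filter_iff[OF U left_almost_invariant_compose[OF f(1), of "\<lambda>m. m = n"]]
      by simp
    have "Lim (end_filter U) (\<lambda>h. \<phi> (f h)) = \<phi> n" for \<phi> :: "nat \<Rightarrow> real"
      by (intro tendsto_Lim end_filter_nontrivial[OF U] tendsto_eventually eventually_mono[OF ev]) simp
    then have "p U = stone_cech_unit ?N n"
      by (simp add: p_def stone_cech_unit_def)
    with U show ?thesis
      by (metis imageI topspace_space_of_ends)
  qed
  \<comment> \<open>The image contains the naturals and is closed, so it contains their closure.\<close>
  then have "stone_cech_unit ?N ` topspace ?N \<subseteq> p ` topspace (space_of_ends G)"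
    by blast
  moreover have "closedin (unit_cube ?N) (p ` topspace (space_of_ends G))"
  proof (rule compactin_imp_closedin)
    show "Hausdorff_space (unit_cube ?N)"
      by (simp add: unit_cube_def Hausdorff_space_product_topology Hausdorff_space_subtopology)
    show "compactin (unit_cube ?N) (p ` topspace (space_of_ends G))"
      using compact_space_of_ends cont_cube unfolding compact_space_def by (rule image_compactin)
  qed
  ultimately have "topspace (stone_cech ?N) \<subseteq> p ` topspace (space_of_ends G)"
    unfolding topspace_stone_cech by (rule closure_of_minimal)
  moreover have "p ` topspace (space_of_ends G) \<subseteq> topspace (stone_cech ?N)"
    using continuous_map_image_subset_topspace[OF cont] .
  ultimately show thesis
    using that[OF cont] by blast
qed

theorem theorem1p12:
  fixes G :: "('a, 'b) monoid_scheme"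
  assumes "group G" and "countable (carrier G)"
  shows "(metrizable_space (space_of_ends G) \<longleftrightarrow>
           \<not> (\<exists>p. continuous_map (space_of_ends G) (stone_cech (discrete_topology (UNIV :: nat set))) p \<and>
                  p ` topspace (space_of_ends G)
                    = topspace (stone_cech (discrete_topology (UNIV :: nat set))))) \<and>
         (\<not> (\<exists>p. continuous_map (space_of_ends G) (stone_cech (discrete_topology (UNIV :: nat set))) p \<and>
                  p ` topspace (space_of_ends G)
                    = topspace (stone_cech (discrete_topology (UNIV :: nat set)))) \<longleftrightarrow>
           tamely_ended G)"
    (is "(?metrizable \<longleftrightarrow> \<not> ?onto) \<and> (\<not> ?onto \<longleftrightarrow> ?tame)")
proof -
  interpret group G
    by (rule assms(1))
  have "?tame \<Longrightarrow> ?metrizable"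
    using tamely_ended_imp_countable_left_commensurated[OF assms(2)] by (rule metrizable_space_of_ends_if_countable)
  moreover have "?metrizable \<Longrightarrow> \<not> ?onto"
    using compact_metrizable_no_map_onto_stone_cech_nat[OF compact_space_of_ends] by blast
  moreover have "\<not> ?tame \<Longrightarrow> ?onto"
    using untamely_ended_map_onto_stone_cech_nat[OF assms(2)] by metis
  ultimately show ?thesis
    by blast
qed

end
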